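(* Let $n\ge 1$, let $1\le k\le n$, and let $\alpha\in A_0$ be any even virtual symbol. Then, in $\mathbf{U}(gl(m_0|m_1+n))$, for every $e_{i,j}\in gl(n)$ ($i,j\in\{1,\dots,n\}$), $$ad(e_{i,j})\Big(\sum_{1\le i_1<\cdots<i_k\le n} e_{i_k,\alpha}\cdots e_{i_2,\alpha}\,e_{i_1,\alpha}\; e_{\alpha,i_1}e_{\alpha,i_2}\cdots e_{\alpha,i_k}\Big)=0 .$$
   Context: $gl(m_0|m_1+n)$ (with $m_0\ge 1$) is the complex general linear Lie superalgebra with standard basis $e_{a,b}$, where $a,b\in A_0\cup A_1\cup L$, $A_0=\{\alpha_1,\dots,\alpha_{m_0}\}$ (symbols of parity $0$), $A_1=\{\beta_1,\dots,\beta_{m_1}\}$ (parity $1$), $L=\{1,\dots,n\}$ (parity $1$); symbols in $A_0\cup A_1$ are called virtual. The parity of $e_{a,b}$ is $|e_{a,b}|=|a|+|b|\in\mathbb Z_2$ and the supercommutator is $[e_{a,b},e_{c,d}]=\delta_{bc}e_{a,d}-(-1)^{(|a|+|b|)(|c|+|d|)}\delta_{ad}e_{c,b}$. The Lie algebra $gl(n)$ is the (even) subalgebra spanned by $e_{i,j}$, $i,j\in L$; for $e_{i,j}\in gl(n)$, $ad(e_{i,j})$ denotes the adjoint action on $\mathbf{U}(gl(m_0|m_1+n))$, $ad(e_{i,j})(u)=e_{i,j}u-u\,e_{i,j}$. *)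

theory Defs
  imports Complex_Main "HOL-Library.Poly_Mapping" "HOL-Algebra.QuotRing"
begin

section \<open>Free associative complex algebras\<close>

text \<open>A wrapper for lists, so that concatenation can be the monoid operation that the
  convolution product of \<^typ>\<open>'g \<Rightarrow>\<^sub>0 complex\<close> expects. That operation is
  written additively by Poly-Mapping, although it is not commutative.\<close>

datatype 'g fword = FWord (letters: "'g list")

instantiation fword :: (type) monoid_add
begin
definition zero_fword :: "'g fword" where "zero_fword = FWord []"
definition plus_fword :: "'g fword \<Rightarrow> 'g fword \<Rightarrow> 'g fword"
  where "plus_fword v w = FWord (letters v @ letters w)"
instance
  by standard (simp_all add: zero_fword_def plus_fword_def)
end

type_synonym 'g fpoly = "'g fword \<Rightarrow>\<^sub>0 complex"

definition fgen :: "'g \<Rightarrow> 'g fpoly"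
  where "fgen g = Poly_Mapping.single (FWord [g]) 1"

text \<open>The free unital associative algebra on the set \<open>G\<close>, i.e. the tensor algebra of the
  complex vector space with basis \<open>G\<close>. The scalars are the multiples of the unit, so the two-sided
  ideals of this ring are the two-sided ideals of the algebra.\<close>

definition free_algebra :: "'g set \<Rightarrow> 'g fpoly ring"
  where "free_algebra G =
    \<lparr>carrier = {p. \<forall>w \<in> Poly_Mapping.keys p. set (letters w) \<subseteq> G},
     mult = (*), one = 1, zero = 0, add = (+)\<rparr>"

lemma ring_free_algebra: "ring (free_algebra G)"
proof (rule ringI)
  show "abelian_group (free_algebra G)"
  proof (rule abelian_groupI)
    fix x assume x: "x \<in> carrier (free_algebra G)"
    show "\<exists>y\<in>carrier (free_algebra G). y \<oplus>\<^bsub>free_algebra G\<^esub> x = \<zero>\<^bsub>free_algebra G\<^esub>"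
      using x by (intro bexI[of _ "- x"]) (auto simp: free_algebra_def)
  next
    fix x y assume "x \<in> carrier (free_algebra G)" "y \<in> carrier (free_algebra G)"
    then show "x \<oplus>\<^bsub>free_algebra G\<^esub> y \<in> carrier (free_algebra G)"
      using keys_add[of x y] by (auto simp: free_algebra_def)
  qed (simp_all add: free_algebra_def add_ac)
  show "Group.monoid (free_algebra G)"
  proof (rule monoidI)
    fix x y assume "x \<in> carrier (free_algebra G)" "y \<in> carrier (free_algebra G)"
    then show "x \<otimes>\<^bsub>free_algebra G\<^esub> y \<in> carrier (free_algebra G)"
      using keys_mult[of x y] by (fastforce simp: free_algebra_def plus_fword_def)
  qed (simp_all add: free_algebra_def mult.assoc zero_fword_def)
qed (simp_all add: free_algebra_def distrib_left distrib_right)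

section \<open>The enveloping algebra of the general linear Lie superalgebra\<close>

text \<open>\<open>Alpha s\<close>, \<open>Beta t\<close> and \<open>Prop i\<close> stand for $\alpha_s$, $\beta_t$ and the proper
  symbol $i \in L$.\<close>

datatype symb = Alpha nat | Beta nat | Prop nat

definition A0 :: "nat \<Rightarrow> symb set" where "A0 m0 = Alpha ` {1..m0}"
definition A1 :: "nat \<Rightarrow> symb set" where "A1 m1 = Beta ` {1..m1}"
definition L :: "nat \<Rightarrow> symb set" where "L n = Prop ` {1..n}"

text \<open>Representatives 0 and 1 of the parities; exponents of $-1$ only matter modulo 2.\<close>

fun parity :: "symb \<Rightarrow> nat" where
  "parity (Alpha s) = 0"
| "parity (Beta t) = 1"
| "parity (Prop i) = 1"

text \<open>The pair \<open>(a, b)\<close> names the basis element $e_{a,b}$.\<close>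

definition gl_basis :: "nat \<Rightarrow> nat \<Rightarrow> nat \<Rightarrow> (symb \<times> symb) set"
  where "gl_basis m0 m1 n = (A0 m0 \<union> A1 m1 \<union> L n) \<times> (A0 m0 \<union> A1 m1 \<union> L n)"

definition koszul_sign :: "symb \<times> symb \<Rightarrow> symb \<times> symb \<Rightarrow> complex"
  where "koszul_sign x y = (- 1) ^ ((parity (fst x) + parity (snd x)) * (parity (fst y) + parity (snd y)))"

text \<open>The supercommutator $[e_{a,b}, e_{c,d}]$, as an element of degree one of the free algebra.\<close>

definition gl_bracket :: "symb \<times> symb \<Rightarrow> symb \<times> symb \<Rightarrow> (symb \<times> symb) fpoly"
  where "gl_bracket x y = (case (x, y) of ((a, b), (c, d)) \<Rightarrow>
    (if b = c then fgen (a, d) else 0)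
    - Poly_Mapping.single 0 (koszul_sign (a, b) (c, d)) * (if a = d then fgen (c, b) else 0))"

text \<open>Here \<open>Poly_Mapping.single 0 c\<close> is the scalar \<open>c\<close>, since \<open>0\<close> is the empty word. By
  bilinearity, imposing these relations on the basis imposes them on all homogeneous elements.\<close>

definition gl_relations :: "nat \<Rightarrow> nat \<Rightarrow> nat \<Rightarrow> (symb \<times> symb) fpoly set"
  where "gl_relations m0 m1 n =
    {fgen x * fgen y - Poly_Mapping.single 0 (koszul_sign x y) * (fgen y * fgen x) - gl_bracket x y
     | x y. x \<in> gl_basis m0 m1 n \<and> y \<in> gl_basis m0 m1 n}"

definition Ugl_ideal :: "nat \<Rightarrow> nat \<Rightarrow> nat \<Rightarrow> (symb \<times> symb) fpoly set"
  where "Ugl_ideal m0 m1 n = Idl\<^bsub>free_algebra (gl_basis m0 m1 n)\<^esub> (gl_relations m0 m1 n)"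

definition Ugl :: "nat \<Rightarrow> nat \<Rightarrow> nat \<Rightarrow> (symb \<times> symb) fpoly set ring"
  where "Ugl m0 m1 n = free_algebra (gl_basis m0 m1 n) Quot Ugl_ideal m0 m1 n"

definition Ugl_e :: "nat \<Rightarrow> nat \<Rightarrow> nat \<Rightarrow> symb \<Rightarrow> symb \<Rightarrow> (symb \<times> symb) fpoly set"
  where "Ugl_e m0 m1 n a b = Ugl_ideal m0 m1 n +>\<^bsub>free_algebra (gl_basis m0 m1 n)\<^esub> fgen (a, b)"

lemma fgen_closed: "g \<in> G \<Longrightarrow> fgen g \<in> carrier (free_algebra G)"
  by (simp add: fgen_def free_algebra_def)

lemma gl_relations_closed: "gl_relations m0 m1 n \<subseteq> carrier (free_algebra (gl_basis m0 m1 n))"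
proof -
  let ?C = "carrier (free_algebra (gl_basis m0 m1 n))"
  have times: "p * q \<in> ?C" if "p \<in> ?C" "q \<in> ?C" for p q
    using monoid.m_closed[OF ring.is_monoid[OF ring_free_algebra] that] by (simp add: free_algebra_def)
  have diff: "p - q \<in> ?C" if "p \<in> ?C" "q \<in> ?C" for p q
    using that keys_diff[of p q] by (auto simp: free_algebra_def)
  have scal: "Poly_Mapping.single 0 c \<in> ?C" and zero: "0 \<in> ?C" for c :: complex
    by (auto simp: free_algebra_def zero_fword_def)
  have bracket: "gl_bracket x y \<in> ?C" if "x \<in> gl_basis m0 m1 n" "y \<in> gl_basis m0 m1 n" for x y
  proof -
    obtain a b c d where xy: "x = (a, b)" "y = (c, d)" by (cases x, cases y)
    then have "(a, d) \<in> gl_basis m0 m1 n" "(c, b) \<in> gl_basis m0 m1 n"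
      using that by (simp_all add: gl_basis_def)
    then show ?thesis
      unfolding gl_bracket_def xy prod.case
      by (intro diff times scal) (simp_all add: fgen_closed zero)
  qed
  show ?thesis
  proof
    fix r assume "r \<in> gl_relations m0 m1 n"
    then obtain x y where xy: "x \<in> gl_basis m0 m1 n" "y \<in> gl_basis m0 m1 n"
      and r: "r = fgen x * fgen y - Poly_Mapping.single 0 (koszul_sign x y) * (fgen y * fgen x)
        - gl_bracket x y"
      unfolding gl_relations_def by blast
    show "r \<in> ?C"
      unfolding r by (intro diff times scal bracket fgen_closed xy)
  qed
qed

lemma ideal_Ugl_ideal: "ideal (Ugl_ideal m0 m1 n) (free_algebra (gl_basis m0 m1 n))"
  unfolding Ugl_ideal_def
  by (intro ring.genideal_ideal ring_free_algebra gl_relations_closed)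

lemma ring_Ugl: "ring (Ugl m0 m1 n)"
  unfolding Ugl_def by (rule ideal.quotient_is_ring[OF ideal_Ugl_ideal])

lemma Ugl_e_closed:
  assumes "a \<in> A0 m0 \<union> A1 m1 \<union> L n" and "b \<in> A0 m0 \<union> A1 m1 \<union> L n"
  shows "Ugl_e m0 m1 n a b \<in> carrier (Ugl m0 m1 n)"
  unfolding Ugl_e_def Ugl_def
  using assms by (intro ring_hom_closed[OF ideal.rcos_ring_hom[OF ideal_Ugl_ideal]] fgen_closed)
    (simp add: gl_basis_def)

section \<open>Adjoint action and ordered products\<close>

definition ad :: "('a, 'm) ring_scheme \<Rightarrow> 'a \<Rightarrow> 'a \<Rightarrow> 'a"
  where "ad R x u = x \<otimes>\<^bsub>R\<^esub> u \<ominus>\<^bsub>R\<^esub> u \<otimes>\<^bsub>R\<^esub> x"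

definition list_product :: "('a, 'm) monoid_scheme \<Rightarrow> 'a list \<Rightarrow> 'a"
  where "list_product R xs = foldr (\<lambda>x y. x \<otimes>\<^bsub>R\<^esub> y) xs \<one>\<^bsub>R\<^esub>"

definition increasing_tuples :: "nat \<Rightarrow> nat \<Rightarrow> nat list set"
  where "increasing_tuples k n = {is. length is = k \<and> sorted_wrt (<) is \<and> set is \<subseteq> {1..n}}"

text \<open>Needed because \<^const>\<open>finsum\<close> over an infinite set is \<open>\<zero>\<close>.\<close>

lemma finite_increasing_tuples: "finite (increasing_tuples k n)"
  by (rule finite_subset[OF _ finite_lists_length_eq[of "{1..n}" k]])
    (auto simp: increasing_tuples_def)

end

theory Submission
  imports Defs
begin

text \<open>Put \<open>x h = e\<^bsub>h,\<alpha>\<^esub>\<close> and \<open>y h = e\<^bsub>\<alpha>,h\<^esub>\<close>, and let \<open>E k\<close> be the sum in question. The \<open>x h\<close>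
  anticommute pairwise and so do the \<open>y h\<close>, hence the operators \<open>u \<mapsto> x h u y h\<close> commute
  with each other and have square zero. As \<open>E k\<close> is their \<open>k\<close>-th elementary symmetric polynomial
  applied to \<open>1\<close>, one gets \<open>(k + 1) E (k + 1) = (\<Sum>h. x h (E k) y h)\<close>. If \<open>e\<^bsub>i,j\<^esub>\<close> commutes with
  \<open>E k\<close>, then its commutator with the right-hand side is \<open>x i (E k) y j - x i (E k) y j = 0\<close>;
  the enveloping algebra is torsion-free, so induction on \<open>k\<close> applies.\<close>

section \<open>Sums of sandwich products of anticommuting families\<close>

lemma increasing_tuples_0: "increasing_tuples 0 m = {[]}"
  by (auto simp: increasing_tuples_def)

lemma increasing_tuples_Suc_0: "increasing_tuples (Suc k) 0 = {}"
  by (auto simp: increasing_tuples_def)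

text \<open>The last entry is the largest. If it equals \<open>Suc m\<close>, deleting it leaves
  entries at most \<open>m\<close>; otherwise all entries are already at most
  \<open>m\<close>.\<close>

lemma increasing_tuples_Suc_Suc:
  "increasing_tuples (Suc k) (Suc m) =
    increasing_tuples (Suc k) m \<union> (\<lambda>is. is @ [Suc m]) ` increasing_tuples k m"
proof (intro equalityI subsetI)
  fix xs assume xs: "xs \<in> increasing_tuples (Suc k) (Suc m)"
  then have "xs \<noteq> []" by (auto simp: increasing_tuples_def)
  then obtain ys a where ys: "xs = ys @ [a]" by (metis rev_exhaust)
  have len: "length ys = k" and srt: "sorted_wrt (<) ys" and lt: "\<And>b. b \<in> set ys \<Longrightarrow> b < a"
    and rng: "set ys \<subseteq> {1..Suc m}" "a \<in> {1..Suc m}"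
    using xs by (auto simp: increasing_tuples_def ys sorted_wrt_append)
  have sub: "set ys \<subseteq> {1..m}" using lt rng by force
  show "xs \<in> increasing_tuples (Suc k) m \<union> (\<lambda>is. is @ [Suc m]) ` increasing_tuples k m"
  proof (cases "a = Suc m")
    case True
    then show ?thesis using len srt sub by (auto simp: ys increasing_tuples_def)
  next
    case False
    then show ?thesis using len srt sub lt rng
      by (auto simp: ys increasing_tuples_def sorted_wrt_append)
  qed
next
  fix xs assume "xs \<in> increasing_tuples (Suc k) m \<union> (\<lambda>is. is @ [Suc m]) ` increasing_tuples k m"
  then show "xs \<in> increasing_tuples (Suc k) (Suc m)"
    by (fastforce simp: increasing_tuples_def sorted_wrt_append)
qed

context monoid
begin

lemma list_product_closed: "set xs \<subseteq> carrier G \<Longrightarrow> list_product G xs \<in> carrier G"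
  by (induction xs) (auto simp: list_product_def)

lemma list_product_Cons: "list_product G (a # xs) = a \<otimes> list_product G xs"
  by (simp add: list_product_def)

text \<open>\<open>list_product\<close> nests to the right, so splitting off the rightmost factor
  takes an induction with associativity.\<close>

lemma list_product_snoc:
  assumes "set xs \<subseteq> carrier G" "a \<in> carrier G"
  shows "list_product G (xs @ [a]) = list_product G xs \<otimes> a"
  using assms
proof (induction xs)
  case Nil
  then show ?case by (simp add: list_product_def)
next
  case (Cons b xs)
  then show ?case by (simp add: list_product_Cons list_product_closed m_assoc)
qed

end

text \<open>The families are indexed by all naturals, so that the algebra below carries no range
  conditions. Torsion-freeness serves twice: it turns anticommutation of an element with itself into
  a vanishing square, and it cancels the factor \<open>Suc k\<close> in the induction.\<close>

locale anticommuting_families = ring R for R (structure) +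
  fixes x y :: "nat \<Rightarrow> 'a"
  assumes x_closed [simp, intro]: "x a \<in> carrier R"
    and y_closed [simp, intro]: "y a \<in> carrier R"
    and x_anticommute: "x a \<otimes> x b \<oplus> x b \<otimes> x a = \<zero>"
    and y_anticommute: "y a \<otimes> y b \<oplus> y b \<otimes> y a = \<zero>"
    and torsion_free: "\<lbrakk>u \<in> carrier R; [Suc k] \<cdot> u = \<zero>\<rbrakk> \<Longrightarrow> u = \<zero>"
begin

lemma add_pow_cancel:
  assumes "u \<in> carrier R" "v \<in> carrier R" "[Suc k] \<cdot> u = [Suc k] \<cdot> v"
  shows "u = v"
proof -
  have "[Suc k] \<cdot> (u \<oplus> \<ominus> v) = [Suc k] \<cdot> u \<oplus> \<ominus> ([Suc k] \<cdot> v)"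
    using assms(1,2) by (simp only: add.nat_pow_distrib add.nat_pow_inv a_inv_closed)
  also have "\<dots> = \<zero>"
    using assms by (simp only: r_neg add.nat_pow_closed)
  finally have "u \<oplus> \<ominus> v = \<zero>"
    using assms(1,2) by (intro torsion_free[of "u \<oplus> \<ominus> v" k]) simp_all
  then show ?thesis
    using assms(1,2) minus_equality[of u "\<ominus> v"] by simp
qed

section \<open>Sandwich operators and their elementary symmetric sums\<close>

definition sandwich :: "nat \<Rightarrow> 'a \<Rightarrow> 'a"
  where "sandwich h u = x h \<otimes> u \<otimes> y h"

text \<open>The bound \<open>m\<close> on the indices is a separate argument because the counting
  identity below is proved by induction on it.\<close>

definition tuple_sum :: "nat \<Rightarrow> nat \<Rightarrow> 'a"
  where "tuple_sum k m = (\<Oplus>is \<in> increasing_tuples k m.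
    list_product R (map x (rev is)) \<otimes> list_product R (map y is))"

lemma sandwich_closed [simp, intro]: "u \<in> carrier R \<Longrightarrow> sandwich h u \<in> carrier R"
  by (simp add: sandwich_def)

lemma sandwich_zero [simp]: "sandwich h \<zero> = \<zero>"
  by (simp add: sandwich_def)

lemma sandwich_add:
  "\<lbrakk>u \<in> carrier R; v \<in> carrier R\<rbrakk> \<Longrightarrow> sandwich h (u \<oplus> v) = sandwich h u \<oplus> sandwich h v"
  by (simp add: sandwich_def l_distr r_distr)

lemma sandwich_add_pow:
  "u \<in> carrier R \<Longrightarrow> sandwich h ([(k::nat)] \<cdot> u) = [k] \<cdot> sandwich h u"
  by (simp add: sandwich_def add_pow_ldistr add_pow_rdistr)

lemma sandwich_finsum:
  assumes "finite A" "f \<in> A \<rightarrow> carrier R"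
  shows "sandwich h (\<Oplus>a\<in>A. f a) = (\<Oplus>a\<in>A. sandwich h (f a))"
  using assms by (induction A rule: finite_induct) (simp_all add: sandwich_add Pi_def)

text \<open>Exchanging the two left factors and exchanging the two right factors each costs a sign,
  and the two signs cancel.\<close>

lemma sandwich_commute:
  assumes "u \<in> carrier R"
  shows "sandwich a (sandwich b u) = sandwich b (sandwich a u)"
proof -
  have x: "x a \<otimes> x b = \<ominus> (x b \<otimes> x a)"
    using x_anticommute[of a b] by (simp add: minus_equality)
  have y: "y b \<otimes> y a = \<ominus> (y a \<otimes> y b)"
    using y_anticommute[of b a] by (simp add: minus_equality)
  have "sandwich a (sandwich b u) = (x a \<otimes> x b) \<otimes> u \<otimes> (y b \<otimes> y a)"
    using assms by (simp add: sandwich_def m_assoc)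
  also have "\<dots> = (x b \<otimes> x a) \<otimes> u \<otimes> (y a \<otimes> y b)"
    unfolding x y using assms by (simp add: l_minus r_minus)
  also have "\<dots> = sandwich b (sandwich a u)"
    using assms by (simp add: sandwich_def m_assoc)
  finally show ?thesis .
qed

lemma sandwich_sandwich_eq_zero:
  assumes "u \<in> carrier R"
  shows "sandwich a (sandwich a u) = \<zero>"
proof -
  \<comment> \<open>Anticommutation with both indices equal to \<open>a\<close> says that twice this
    square is zero; the multiple 2 is \<open>Suc 1\<close>.\<close>
  have "x a \<otimes> x a = \<zero>"
    using x_anticommute[of a a] torsion_free[of "x a \<otimes> x a" 1] by (simp add: add_pow_def)
  moreover have "sandwich a (sandwich a u) = (x a \<otimes> x a) \<otimes> u \<otimes> (y a \<otimes> y a)"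
    using assms by (simp add: sandwich_def m_assoc)
  ultimately show ?thesis using assms by simp
qed

lemma tuple_sum_0 [simp]: "tuple_sum 0 m = \<one>"
  by (simp add: tuple_sum_def increasing_tuples_0 list_product_def)

lemma tuple_sum_Suc_0 [simp]: "tuple_sum (Suc k) 0 = \<zero>"
  by (simp add: tuple_sum_def increasing_tuples_Suc_0)

lemma tuple_product_closed [simp]:
  "list_product R (map x (rev is)) \<otimes> list_product R (map y is) \<in> carrier R"
  by (intro m_closed list_product_closed) auto

lemma tuple_sum_closed [simp, intro]: "tuple_sum k m \<in> carrier R"
  unfolding tuple_sum_def by (intro finsum_closed) simp

text \<open>The usual recursion for elementary symmetric polynomials. Appending \<open>Suc m\<close>
  to a tuple puts \<open>x (Suc m)\<close> leftmost, because of the reversal, and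
  \<open>y (Suc m)\<close> rightmost, so it applies \<open>sandwich (Suc m)\<close> to the old
  product.\<close>

lemma tuple_sum_Suc_Suc:
  "tuple_sum (Suc k) (Suc m) = tuple_sum (Suc k) m \<oplus> sandwich (Suc m) (tuple_sum k m)"
proof -
  let ?P = "\<lambda>is. list_product R (map x (rev is)) \<otimes> list_product R (map y is)"
  let ?s = "\<lambda>is. is @ [Suc m]"
  have snoc: "?P (?s is) = sandwich (Suc m) (?P is)" for "is"
  proof -
    have "list_product R (map y is) \<in> carrier R" "list_product R (map x (rev is)) \<in> carrier R"
      by (auto intro!: list_product_closed)
    moreover have "list_product R (map y is @ [y (Suc m)]) = list_product R (map y is) \<otimes> y (Suc m)"
      by (intro list_product_snoc) auto
    ultimately show ?thesis
      by (simp add: list_product_Cons sandwich_def m_assoc)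
  qed
  have disj: "increasing_tuples (Suc k) m \<inter> ?s ` increasing_tuples k m = {}"
    by (auto simp: increasing_tuples_def)
  have "tuple_sum (Suc k) (Suc m) = tuple_sum (Suc k) m \<oplus> (\<Oplus>is \<in> ?s ` increasing_tuples k m. ?P is)"
    unfolding tuple_sum_def increasing_tuples_Suc_Suc
    by (intro finsum_Un_disjoint disj finite_imageI finite_increasing_tuples) auto
  also have "(\<Oplus>is \<in> ?s ` increasing_tuples k m. ?P is) = (\<Oplus>is \<in> increasing_tuples k m. ?P (?s is))"
    by (intro finsum_reindex) (auto simp: inj_on_def simp del: map_append rev_append)
  also have "\<dots> = sandwich (Suc m) (tuple_sum k m)"
    unfolding tuple_sum_def snoc
    by (intro sandwich_finsum[symmetric] finite_increasing_tuples) simp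
  finally show ?thesis .
qed

text \<open>Each increasing tuple of length \<open>k + 1\<close> arises \<open>k + 1\<close> times,
  once for each entry that can be the outermost index, while repeated indices contribute zero. The
  formal proof is an induction on \<open>m\<close>; \<open>k\<close> stays arbitrary because the
  recursion also lowers the degree.\<close>

lemma finsum_sandwich_tuple_sum:
  "(\<Oplus>h \<in> {1..m}. sandwich h (tuple_sum k m)) = [Suc k] \<cdot> tuple_sum (Suc k) m"
proof (induction m arbitrary: k)
  case 0
  show ?case by simp
next
  case (Suc m)
  have split: "(\<Oplus>h \<in> {1..Suc m}. sandwich h u)
      = sandwich (Suc m) u \<oplus> (\<Oplus>h \<in> {1..m}. sandwich h u)" if "u \<in> carrier R" for u
    using that by (simp add: atLeastAtMostSuc_conv)
  \<comment> \<open>Degree 0 is separate: there the recursion does not apply, and the sum is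
    \<open>\<one>\<close> for every bound.\<close>
  show ?case
  proof (cases k)
    case 0
    then show ?thesis
      using Suc.IH[of 0] by (simp add: split tuple_sum_Suc_Suc a_comm del: One_nat_def)
  next
    case (Suc l)
    \<comment> \<open>Since the operators commute, \<open>sandwich (Suc m)\<close> can be pulled out
      of the second sum; the induction hypothesis is then used in degrees \<open>Suc l\<close> and
      \<open>l\<close>.\<close>
    have step: "(\<Oplus>h \<in> {1..m}. sandwich h (tuple_sum (Suc l) m \<oplus> sandwich (Suc m) (tuple_sum l m)))
      = [Suc (Suc l)] \<cdot> tuple_sum (Suc (Suc l)) m
        \<oplus> [Suc l] \<cdot> sandwich (Suc m) (tuple_sum (Suc l) m)"
    proof -
      have "(\<Oplus>h \<in> {1..m}. sandwich h (tuple_sum (Suc l) m \<oplus> sandwich (Suc m) (tuple_sum l m)))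
        = (\<Oplus>h \<in> {1..m}. sandwich h (tuple_sum (Suc l) m)) \<oplus>
          (\<Oplus>h \<in> {1..m}. sandwich (Suc m) (sandwich h (tuple_sum l m)))"
        by (simp add: sandwich_add finsum_addf sandwich_commute[of _ _ "Suc m"])
      also have "(\<Oplus>h \<in> {1..m}. sandwich (Suc m) (sandwich h (tuple_sum l m)))
        = sandwich (Suc m) (\<Oplus>h \<in> {1..m}. sandwich h (tuple_sum l m))"
        by (simp add: sandwich_finsum)
      finally show ?thesis
        by (simp only: Suc.IH sandwich_add_pow tuple_sum_closed)
    qed
    \<comment> \<open>In the summand for \<open>h = Suc m\<close>, the part already containing
      \<open>sandwich (Suc m)\<close> dies. The remaining copy raises the coefficient
      \<open>Suc l\<close> from \<open>step\<close> to \<open>Suc (Suc l)\<close>.\<close>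
    have "(\<Oplus>h \<in> {1..Suc m}. sandwich h (tuple_sum k (Suc m)))
      = sandwich (Suc m) (tuple_sum (Suc l) m)
        \<oplus> ([Suc (Suc l)] \<cdot> tuple_sum (Suc (Suc l)) m
        \<oplus> [Suc l] \<cdot> sandwich (Suc m) (tuple_sum (Suc l) m))"
      unfolding Suc tuple_sum_Suc_Suc
      by (subst split) (simp_all only: step sandwich_add[of "tuple_sum (Suc l) m" _ "Suc m"]
        sandwich_sandwich_eq_zero tuple_sum_closed sandwich_closed r_zero a_closed)
    also have "\<dots> = [Suc (Suc l)] \<cdot> tuple_sum (Suc (Suc l)) m
        \<oplus> ([Suc l] \<cdot> sandwich (Suc m) (tuple_sum (Suc l) m) \<oplus> sandwich (Suc m) (tuple_sum (Suc l) m))"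
      by (simp add: a_ac del: add.nat_pow_Suc)
    also have "[Suc l] \<cdot> sandwich (Suc m) (tuple_sum (Suc l) m) \<oplus> sandwich (Suc m) (tuple_sum (Suc l) m)
        = [Suc (Suc l)] \<cdot> sandwich (Suc m) (tuple_sum (Suc l) m)"
      by (simp add: add_pow_def)
    also have "[Suc (Suc l)] \<cdot> tuple_sum (Suc (Suc l)) m \<oplus> \<dots>
        = [Suc k] \<cdot> tuple_sum (Suc k) (Suc m)"
      unfolding Suc tuple_sum_Suc_Suc
      by (rule add.nat_pow_distrib[symmetric]) auto
    finally show ?thesis .
  qed
qed

text \<open>The hypotheses \<open>ex\<close> and \<open>ye\<close> are the commutators of a matrix
  unit with a vector and a covector. Since \<open>i\<close> and \<open>j\<close> lie in the range,
  multiplying the sum of sandwiches by \<open>e\<close> on the left and on the right yields the same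
  correction \<open>?c\<close> exactly once.\<close>

lemma commutes_tuple_sum:
  assumes e: "e \<in> carrier R" and ij: "i \<in> {1..m}" "j \<in> {1..m}"
    and ex: "\<And>h. e \<otimes> x h = x h \<otimes> e \<oplus> (if h = j then x i else \<zero>)"
    and ye: "\<And>h. y h \<otimes> e = e \<otimes> y h \<oplus> (if h = i then y j else \<zero>)"
  shows "e \<otimes> tuple_sum k m = tuple_sum k m \<otimes> e"
proof (induction k)
  case 0
  show ?case using e by simp
next
  case (Suc k)
  let ?u = "tuple_sum k m" and ?v = "tuple_sum (Suc k) m"
  let ?c = "x i \<otimes> ?u \<otimes> y j"
  \<comment> \<open>Both products are brought to a form with \<open>e\<close> just before
    \<open>y h\<close>: here \<open>e\<close> passes \<open>x h\<close>, then \<open>?u\<close> by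
    the induction hypothesis. The summation index stays in the conditional term so that the sum over
    \<open>h\<close> collapses to one term.\<close>
  have left: "e \<otimes> sandwich h ?u = x h \<otimes> ?u \<otimes> (e \<otimes> y h) \<oplus> (if j = h then x i \<otimes> ?u \<otimes> y h else \<zero>)" for h
  proof -
    have "e \<otimes> sandwich h ?u = (e \<otimes> x h) \<otimes> ?u \<otimes> y h"
      using e by (simp add: sandwich_def m_assoc)
    also have "\<dots> = x h \<otimes> (e \<otimes> ?u) \<otimes> y h \<oplus> (if j = h then x i \<otimes> ?u \<otimes> y h else \<zero>)"
      unfolding ex using e by (simp add: l_distr m_assoc)
    finally show ?thesis unfolding Suc.IH using e by (simp add: m_assoc)
  qed
  \<comment> \<open>From this side \<open>e\<close> only has to pass \<open>y h\<close>.\<close>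
  have right: "sandwich h ?u \<otimes> e = x h \<otimes> ?u \<otimes> (e \<otimes> y h) \<oplus> (if i = h then x h \<otimes> ?u \<otimes> y j else \<zero>)" for h
  proof -
    have "sandwich h ?u \<otimes> e = x h \<otimes> ?u \<otimes> (y h \<otimes> e)"
      using e by (simp add: sandwich_def m_assoc)
    then show ?thesis unfolding ye using e by (simp add: r_distr)
  qed
  let ?s = "\<Oplus>h \<in> {1..m}. sandwich h ?u" and ?t = "\<Oplus>h \<in> {1..m}. x h \<otimes> ?u \<otimes> (e \<otimes> y h)"
  have "e \<otimes> ?s = ?t \<oplus> (\<Oplus>h \<in> {1..m}. if j = h then x i \<otimes> ?u \<otimes> y h else \<zero>)"
    using e by (simp add: finsum_rdistr left finsum_addf)
  also have "\<dots> = ?t \<oplus> ?c"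
    using ij by (subst add.finprod_singleton) auto
  also have "\<dots> = ?t \<oplus> (\<Oplus>h \<in> {1..m}. if i = h then x h \<otimes> ?u \<otimes> y j else \<zero>)"
    using ij by (subst add.finprod_singleton) auto
  also have "\<dots> = ?s \<otimes> e"
    using e by (simp add: finsum_ldistr right finsum_addf)
  finally have "e \<otimes> ([Suc k] \<cdot> ?v) = ([Suc k] \<cdot> ?v) \<otimes> e"
    by (simp only: finsum_sandwich_tuple_sum)
  then have "[Suc k] \<cdot> (e \<otimes> ?v) = [Suc k] \<cdot> (?v \<otimes> e)"
    using e by (simp only: add_pow_ldistr add_pow_rdistr tuple_sum_closed)
  then show ?case
    using e by (intro add_pow_cancel[of "e \<otimes> ?v" "?v \<otimes> e" k] m_closed tuple_sum_closed)
qed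

end

section \<open>Relations in the enveloping algebra\<close>

lemma zero_Ugl: "\<zero>\<^bsub>Ugl m0 m1 n\<^esub> = Ugl_ideal m0 m1 n"
  by (simp add: Ugl_def FactRing_def)

lemma Ugl_representative:
  assumes "u \<in> carrier (Ugl m0 m1 n)"
  obtains p where "p \<in> carrier (free_algebra (gl_basis m0 m1 n))"
    and "u = Ugl_ideal m0 m1 n +>\<^bsub>free_algebra (gl_basis m0 m1 n)\<^esub> p"
  using assms by (auto simp: Ugl_def FactRing_def A_RCOSETS_def')

context
  fixes m0 m1 n :: nat
begin

interpretation F: ring "free_algebra (gl_basis m0 m1 n)"
  by (rule ring_free_algebra)

interpretation U: ring "Ugl m0 m1 n"
  by (rule ring_Ugl)

interpretation I: ideal "Ugl_ideal m0 m1 n" "free_algebra (gl_basis m0 m1 n)"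
  by (rule ideal_Ugl_ideal)

abbreviation (input) "FA \<equiv> free_algebra (gl_basis m0 m1 n)"
abbreviation (input) "cls p \<equiv> Ugl_ideal m0 m1 n +>\<^bsub>free_algebra (gl_basis m0 m1 n)\<^esub> p"

interpretation H: ring_hom_ring "free_algebra (gl_basis m0 m1 n)" "Ugl m0 m1 n"
  "\<lambda>p. Ugl_ideal m0 m1 n +>\<^bsub>free_algebra (gl_basis m0 m1 n)\<^esub> p"
  unfolding Ugl_def by (rule I.rcos_ring_hom_ring)

lemma cls_eq_zero_iff:
  assumes "p \<in> carrier FA"
  shows "cls p = \<zero>\<^bsub>Ugl m0 m1 n\<^esub> \<longleftrightarrow> p \<in> Ugl_ideal m0 m1 n"
  unfolding zero_Ugl
  using F.a_coset_join1[OF _ assms I.a_subgroup] F.a_coset_join2[OF assms I.a_subgroup] by (rule iffI)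

lemma scalar_closed: "Poly_Mapping.single 0 c \<in> carrier FA"
  by (auto simp: free_algebra_def zero_fword_def)

text \<open>Rewrites repeated addition as multiplication by a scalar, which is invertible over the
  complex numbers.\<close>

lemma add_pow_free_algebra: "[(k::nat)] \<cdot>\<^bsub>free_algebra G\<^esub> p = of_nat k * p"
proof (induction k)
  case 0
  show ?case by (simp add: add_pow_def free_algebra_def)
next
  case (Suc k)
  then show ?case by (simp add: add_pow_def free_algebra_def nat_pow_def distrib_right add_ac)
qed

text \<open>The ideal absorbs multiplication by scalars, which are elements of the free algebra. If
  it contains \<open>k + 1\<close> times a representative, multiplying by the inverse scalar
  \<open>?c\<close> shows that it contains the representative itself.\<close>

lemma Ugl_torsion_free:
  assumes u: "u \<in> carrier (Ugl m0 m1 n)"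
    and 0: "[Suc k] \<cdot>\<^bsub>Ugl m0 m1 n\<^esub> u = \<zero>\<^bsub>Ugl m0 m1 n\<^esub>"
  shows "u = \<zero>\<^bsub>Ugl m0 m1 n\<^esub>"
proof -
  obtain p where p: "p \<in> carrier FA" "u = cls p"
    using u by (rule Ugl_representative)
  let ?c = "Poly_Mapping.single 0 (inverse (of_nat (Suc k))) :: (symb \<times> symb) fpoly"
  have hom: "cls ([m] \<cdot>\<^bsub>FA\<^esub> p) = [m] \<cdot>\<^bsub>Ugl m0 m1 n\<^esub> u" for m :: nat
    unfolding p(2) by (induction m)
      (simp_all only: F.add.nat_pow_0 F.add.nat_pow_Suc F.add.nat_pow_closed U.add.nat_pow_0
        U.add.nat_pow_Suc H.hom_zero H.hom_add p(1))
  have "cls ([Suc k] \<cdot>\<^bsub>FA\<^esub> p) = \<zero>\<^bsub>Ugl m0 m1 n\<^esub>"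
    using 0 by (simp only: hom)
  then have "[Suc k] \<cdot>\<^bsub>FA\<^esub> p \<in> Ugl_ideal m0 m1 n"
    using p(1) by (subst (asm) cls_eq_zero_iff) auto
  then have "?c \<otimes>\<^bsub>FA\<^esub> ([Suc k] \<cdot>\<^bsub>FA\<^esub> p) \<in> Ugl_ideal m0 m1 n"
    by (rule I.I_l_closed[OF _ scalar_closed])
  moreover have "?c \<otimes>\<^bsub>FA\<^esub> ([Suc k] \<cdot>\<^bsub>FA\<^esub> p) = p"
  proof -
    have "?c * of_nat (Suc k) = 1"
      by (simp add: mult_single flip: single_of_nat del: of_nat_Suc)
    then show ?thesis
      unfolding add_pow_free_algebra by (simp add: free_algebra_def flip: mult.assoc del: of_nat_Suc)
  qed
  ultimately show ?thesis
    using p by (simp add: cls_eq_zero_iff)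
qed

section \<open>Commutation relations between the generators\<close>

lemma cls_relation:
  assumes "X \<in> gl_basis m0 m1 n" "Y \<in> gl_basis m0 m1 n"
  shows "cls (fgen X * fgen Y - Poly_Mapping.single 0 (koszul_sign X Y) * (fgen Y * fgen X)
    - gl_bracket X Y) = \<zero>\<^bsub>Ugl m0 m1 n\<^esub>" (is "cls ?r = _")
proof -
  have "?r \<in> gl_relations m0 m1 n"
    unfolding gl_relations_def using assms by blast
  then show ?thesis
    using gl_relations_closed F.genideal_self[OF gl_relations_closed]
    by (subst cls_eq_zero_iff) (simp_all only: Ugl_ideal_def subset_iff)
qed

text \<open>With sign -1 the defining relation is an anticommutator, and the two inequalities remove
  both terms of the bracket.\<close>

lemma Ugl_odd_anticommute:
  assumes X: "(a, b) \<in> gl_basis m0 m1 n" and Y: "(c, d) \<in> gl_basis m0 m1 n"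
    and sgn: "koszul_sign (a, b) (c, d) = -1" and "b \<noteq> c" "a \<noteq> d"
  shows "Ugl_e m0 m1 n a b \<otimes>\<^bsub>Ugl m0 m1 n\<^esub> Ugl_e m0 m1 n c d
    \<oplus>\<^bsub>Ugl m0 m1 n\<^esub> Ugl_e m0 m1 n c d \<otimes>\<^bsub>Ugl m0 m1 n\<^esub> Ugl_e m0 m1 n a b = \<zero>\<^bsub>Ugl m0 m1 n\<^esub>"
proof -
  let ?x = "fgen (a, b) :: (symb \<times> symb) fpoly" and ?y = "fgen (c, d) :: (symb \<times> symb) fpoly"
  have [simp]: "?x \<in> carrier FA" "?y \<in> carrier FA"
    using X Y by (simp_all add: fgen_closed)
  have neg: "Poly_Mapping.single 0 (-1) = (-1 :: (symb \<times> symb) fpoly)"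
    by (simp add: single_uminus)
  have "?x * ?y - Poly_Mapping.single 0 (koszul_sign (a, b) (c, d)) * (?y * ?x) - gl_bracket (a, b) (c, d)
    = ?x \<otimes>\<^bsub>FA\<^esub> ?y \<oplus>\<^bsub>FA\<^esub> ?y \<otimes>\<^bsub>FA\<^esub> ?x"
    using assms(4,5) by (simp add: gl_bracket_def sgn neg free_algebra_def)
  then have "cls (?x \<otimes>\<^bsub>FA\<^esub> ?y \<oplus>\<^bsub>FA\<^esub> ?y \<otimes>\<^bsub>FA\<^esub> ?x) = \<zero>\<^bsub>Ugl m0 m1 n\<^esub>"
    using cls_relation[OF X Y] by simp
  then show ?thesis
    by (simp add: Ugl_e_def)
qed

text \<open>With sign 1 the relation is an ordinary commutator. Its negative terms are moved across
  the equation, so that only sums and products have to be carried through the quotient map.\<close>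

lemma Ugl_even_commute:
  assumes X: "(a, b) \<in> gl_basis m0 m1 n" and Y: "(c, d) \<in> gl_basis m0 m1 n"
    and sgn: "koszul_sign (a, b) (c, d) = 1"
  shows "Ugl_e m0 m1 n a b \<otimes>\<^bsub>Ugl m0 m1 n\<^esub> Ugl_e m0 m1 n c d
      \<oplus>\<^bsub>Ugl m0 m1 n\<^esub> (if a = d then Ugl_e m0 m1 n c b else \<zero>\<^bsub>Ugl m0 m1 n\<^esub>)
    = Ugl_e m0 m1 n c d \<otimes>\<^bsub>Ugl m0 m1 n\<^esub> Ugl_e m0 m1 n a b
      \<oplus>\<^bsub>Ugl m0 m1 n\<^esub> (if b = c then Ugl_e m0 m1 n a d else \<zero>\<^bsub>Ugl m0 m1 n\<^esub>)"
proof -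
  let ?x = "fgen (a, b) :: (symb \<times> symb) fpoly" and ?y = "fgen (c, d) :: (symb \<times> symb) fpoly"
  let ?p = "if b = c then fgen (a, d) else \<zero>\<^bsub>FA\<^esub>" and ?q = "if a = d then fgen (c, b) else \<zero>\<^bsub>FA\<^esub>"
  let ?r = "?x * ?y - Poly_Mapping.single 0 (koszul_sign (a, b) (c, d)) * (?y * ?x)
    - gl_bracket (a, b) (c, d)"
  have "(a, d) \<in> gl_basis m0 m1 n" "(c, b) \<in> gl_basis m0 m1 n"
    using X Y by (simp_all add: gl_basis_def)
  then have [simp]: "?x \<in> carrier FA" "?y \<in> carrier FA" "?p \<in> carrier FA" "?q \<in> carrier FA"
    using X Y by (simp_all add: fgen_closed)
  have rel: "?r \<in> carrier FA" "cls ?r = \<zero>\<^bsub>Ugl m0 m1 n\<^esub>"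
    using cls_relation[OF X Y] gl_relations_closed X Y unfolding gl_relations_def by blast+
  have "?x \<otimes>\<^bsub>FA\<^esub> ?y \<oplus>\<^bsub>FA\<^esub> ?q = ?r \<oplus>\<^bsub>FA\<^esub> (?y \<otimes>\<^bsub>FA\<^esub> ?x \<oplus>\<^bsub>FA\<^esub> ?p)"
    by (simp add: gl_bracket_def sgn free_algebra_def)
  then have "cls (?x \<otimes>\<^bsub>FA\<^esub> ?y \<oplus>\<^bsub>FA\<^esub> ?q) = cls (?r \<oplus>\<^bsub>FA\<^esub> (?y \<otimes>\<^bsub>FA\<^esub> ?x \<oplus>\<^bsub>FA\<^esub> ?p))"
    by (rule arg_cong)
  also have "\<dots> = cls (?y \<otimes>\<^bsub>FA\<^esub> ?x \<oplus>\<^bsub>FA\<^esub> ?p)"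
    using rel by (subst H.hom_add) (simp_all del: H.hom_add H.hom_mult)
  finally have "cls ?x \<otimes>\<^bsub>Ugl m0 m1 n\<^esub> cls ?y \<oplus>\<^bsub>Ugl m0 m1 n\<^esub> cls ?q
    = cls ?y \<otimes>\<^bsub>Ugl m0 m1 n\<^esub> cls ?x \<oplus>\<^bsub>Ugl m0 m1 n\<^esub> cls ?p"
    by (simp only: H.hom_add H.hom_mult F.m_closed \<open>?x \<in> carrier FA\<close> \<open>?y \<in> carrier FA\<close>
      \<open>?p \<in> carrier FA\<close> \<open>?q \<in> carrier FA\<close>)
  moreover have "cls ?p = (if b = c then Ugl_e m0 m1 n a d else \<zero>\<^bsub>Ugl m0 m1 n\<^esub>)"
    "cls ?q = (if a = d then Ugl_e m0 m1 n c b else \<zero>\<^bsub>Ugl m0 m1 n\<^esub>)"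
    by (simp_all add: Ugl_e_def)
  ultimately show ?thesis by (simp only: Ugl_e_def)
qed

end

section \<open>Specialization to the enveloping algebra\<close>

theorem proposition4p3:
  fixes m0 m1 n k i j :: nat and \<alpha> :: symb
  assumes "m0 \<ge> 1" and "n \<ge> 1" and "1 \<le> k" and "k \<le> n"
    and "\<alpha> \<in> A0 m0"
    and "i \<in> {1..n}" and "j \<in> {1..n}"
  shows "ad (Ugl m0 m1 n) (Ugl_e m0 m1 n (Prop i) (Prop j))
    (\<Oplus>\<^bsub>Ugl m0 m1 n\<^esub> is \<in> increasing_tuples k n.
        list_product (Ugl m0 m1 n) (map (\<lambda>h. Ugl_e m0 m1 n (Prop h) \<alpha>) (rev is))
        \<otimes>\<^bsub>Ugl m0 m1 n\<^esub>
        list_product (Ugl m0 m1 n) (map (\<lambda>h. Ugl_e m0 m1 n \<alpha> (Prop h)) is))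
    = \<zero>\<^bsub>Ugl m0 m1 n\<^esub>"
proof -
  interpret U: ring "Ugl m0 m1 n" by (rule ring_Ugl)
  let ?U = "Ugl m0 m1 n"
  let ?e = "Ugl_e m0 m1 n (Prop i) (Prop j)"
  \<comment> \<open>Outside \<open>{1..n}\<close> the symbols \<open>Prop h\<close> give no elements of the algebra, so the families are
    extended by zero.\<close>
  define x where "x h = (if h \<in> {1..n} then Ugl_e m0 m1 n (Prop h) \<alpha> else \<zero>\<^bsub>?U\<^esub>)" for h
  define y where "y h = (if h \<in> {1..n} then Ugl_e m0 m1 n \<alpha> (Prop h) else \<zero>\<^bsub>?U\<^esub>)" for h
  obtain s where \<alpha>: "\<alpha> = Alpha s" "\<alpha> \<in> A0 m0 \<union> A1 m1 \<union> L n"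
    using assms(5) by (auto simp: A0_def)
  have L: "Prop h \<in> A0 m0 \<union> A1 m1 \<union> L n" if "h \<in> {1..n}" for h
    using that by (auto simp: L_def)
  have basis: "(Prop h, \<alpha>) \<in> gl_basis m0 m1 n" "(\<alpha>, Prop h) \<in> gl_basis m0 m1 n"
    "(Prop i, Prop j) \<in> gl_basis m0 m1 n" if "h \<in> {1..n}" for h
    using that \<alpha> L assms(6,7) by (simp_all add: gl_basis_def)
  have e: "?e \<in> carrier ?U"
    using L assms by (intro Ugl_e_closed) auto
  have xc: "x h \<in> carrier ?U" and yc: "y h \<in> carrier ?U" for h
    using \<alpha>(2) L by (auto simp: x_def y_def intro!: Ugl_e_closed)
  interpret anticommuting_families ?U x y
  proof
    \<comment> \<open>A proper symbol is odd and \<alpha> is even, so both factors are odd; as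
      \<alpha> differs from every proper symbol, their bracket is zero.\<close>
    show "x a \<otimes>\<^bsub>?U\<^esub> x b \<oplus>\<^bsub>?U\<^esub> x b \<otimes>\<^bsub>?U\<^esub> x a = \<zero>\<^bsub>?U\<^esub>" for a b
    proof (cases "a \<in> {1..n} \<and> b \<in> {1..n}")
      case True
      then show ?thesis
        using Ugl_odd_anticommute[OF basis(1)[of a] basis(1)[of b]]
        by (simp add: x_def \<alpha>(1) koszul_sign_def)
    next
      case False
      then have "x a = \<zero>\<^bsub>?U\<^esub> \<or> x b = \<zero>\<^bsub>?U\<^esub>" by (auto simp: x_def)
      then show ?thesis by (elim disjE) (simp_all only: U.l_null U.r_null U.l_zero U.zero_closed xc)
    qed
    show "y a \<otimes>\<^bsub>?U\<^esub> y b \<oplus>\<^bsub>?U\<^esub> y b \<otimes>\<^bsub>?U\<^esub> y a = \<zero>\<^bsub>?U\<^esub>" for a b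
    proof (cases "a \<in> {1..n} \<and> b \<in> {1..n}")
      case True
      then show ?thesis
        using Ugl_odd_anticommute[OF basis(2)[of a] basis(2)[of b]]
        by (simp add: y_def \<alpha>(1) koszul_sign_def)
    next
      case False
      then have "y a = \<zero>\<^bsub>?U\<^esub> \<or> y b = \<zero>\<^bsub>?U\<^esub>" by (auto simp: y_def)
      then show ?thesis by (elim disjE) (simp_all only: U.l_null U.r_null U.l_zero U.zero_closed yc)
    qed
  qed (fact xc yc Ugl_torsion_free)+
  \<comment> \<open>The element \<open>?e\<close> has parity sum 2, so the sign is 1. Of the two
    bracket terms only the one for \<open>h = j\<close> survives, as \<alpha> is not proper.\<close>
  have ex: "?e \<otimes>\<^bsub>?U\<^esub> x h = x h \<otimes>\<^bsub>?U\<^esub> ?e \<oplus>\<^bsub>?U\<^esub> (if h = j then x i else \<zero>\<^bsub>?U\<^esub>)" for h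
  proof (cases "h \<in> {1..n}")
    case True
    have "koszul_sign (Prop i, Prop j) (Prop h, \<alpha>) = 1" by (simp add: koszul_sign_def \<alpha>(1))
    from Ugl_even_commute[OF basis(3,1)[OF True] this] show ?thesis
      using True assms(6) e xc[of h] by (auto simp: x_def \<alpha>(1))
  next
    \<comment> \<open>Here \<open>x h\<close> is zero, and \<open>h = j\<close> is impossible
      because \<open>j\<close> is in the range.\<close>
    case False
    then show ?thesis using e assms(7) by (auto simp: x_def)
  qed
  \<comment> \<open>Now the surviving bracket term is the negative one, for \<open>h = i\<close>,
    which is why \<open>y h\<close> stands to the left of \<open>?e\<close>.\<close>
  have ye: "y h \<otimes>\<^bsub>?U\<^esub> ?e = ?e \<otimes>\<^bsub>?U\<^esub> y h \<oplus>\<^bsub>?U\<^esub> (if h = i then y j else \<zero>\<^bsub>?U\<^esub>)" for h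
  proof (cases "h \<in> {1..n}")
    case True
    have "koszul_sign (Prop i, Prop j) (\<alpha>, Prop h) = 1" by (simp add: koszul_sign_def \<alpha>(1))
    from Ugl_even_commute[OF basis(3,2)[OF True] this]
    have "?e \<otimes>\<^bsub>?U\<^esub> y h \<oplus>\<^bsub>?U\<^esub> (if h = i then y j else \<zero>\<^bsub>?U\<^esub>) = y h \<otimes>\<^bsub>?U\<^esub> ?e \<oplus>\<^bsub>?U\<^esub> \<zero>\<^bsub>?U\<^esub>"
      using True assms(7) by (simp only: y_def \<alpha>(1) symb.inject symb.distinct if_True if_False eq_commute[of i h])
    then show ?thesis
      by (simp only: U.r_zero U.m_closed e yc)
  next
    case False
    then show ?thesis using e assms(6) by (auto simp: y_def)
  qed
  \<comment> \<open>All indices of the tuples lie in \<open>{1..n}\<close>, where the extended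
    families agree with the generators.\<close>
  have "tuple_sum k n = (\<Oplus>\<^bsub>?U\<^esub> is \<in> increasing_tuples k n.
        list_product ?U (map (\<lambda>h. Ugl_e m0 m1 n (Prop h) \<alpha>) (rev is))
        \<otimes>\<^bsub>?U\<^esub> list_product ?U (map (\<lambda>h. Ugl_e m0 m1 n \<alpha> (Prop h)) is))"
    unfolding tuple_sum_def
  proof (intro U.add.finprod_cong' refl)
    fix "is" assume "is \<in> increasing_tuples k n"
    then have "set is \<subseteq> {1..n}" by (simp add: increasing_tuples_def)
    then have "map x (rev is) = map (\<lambda>h. Ugl_e m0 m1 n (Prop h) \<alpha>) (rev is)"
      "map y is = map (\<lambda>h. Ugl_e m0 m1 n \<alpha> (Prop h)) is"
      by (auto simp: x_def y_def)
    then show "list_product ?U (map x (rev is)) \<otimes>\<^bsub>?U\<^esub> list_product ?U (map y is)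
      = list_product ?U (map (\<lambda>h. Ugl_e m0 m1 n (Prop h) \<alpha>) (rev is))
        \<otimes>\<^bsub>?U\<^esub> list_product ?U (map (\<lambda>h. Ugl_e m0 m1 n \<alpha> (Prop h)) is)"
      by (simp only:)
  next
    show "(\<lambda>is. list_product ?U (map (\<lambda>h. Ugl_e m0 m1 n (Prop h) \<alpha>) (rev is))
        \<otimes>\<^bsub>?U\<^esub> list_product ?U (map (\<lambda>h. Ugl_e m0 m1 n \<alpha> (Prop h)) is))
      \<in> increasing_tuples k n \<rightarrow> carrier ?U"
      using \<alpha>(2) L by (fastforce simp: increasing_tuples_def
        intro!: U.m_closed U.list_product_closed Ugl_e_closed)
  qed
  moreover have "ad ?U ?e (tuple_sum k n) = \<zero>\<^bsub>?U\<^esub>"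
    unfolding ad_def commutes_tuple_sum[OF e assms(6,7) ex ye]
    by (simp only: a_minus_def U.r_neg U.m_closed e tuple_sum_closed)
  ultimately show ?thesis
    by (simp only:)
qed

end
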